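(* Let $n>4$ be an integer and let $l_1,l_2$ be real numbers satisfying the parameter constraints (a)--(f) of the context. Consider the $n$-petal tree linkage with parameters $n,l_1,l_2$ in a configuration such that $\theta_i\in(\alpha,\beta)$ for all $0\le i<n$ and such that each petal is in a restricted configuration. Then during any motion of the linkage starting from this configuration, all petal angles $\theta_i$ remain in the range $(\alpha,\beta)$.
   Context: Linkages. A tree linkage is a tree whose edges are labelled with positive numbers. A configuration of it in the plane maps each vertex to a point (joint) and each edge to the closed segment (link) between its end joints, whose length equals the label, such that any two links whose underlying edges share a vertex intersect only at the common joint, and all other pairs of links are disjoint (so every configuration is simple). A motion is a continuous movement of the joints such that the linkage is in a configuration at all times. The $n$-petal tree. It has a central joint $O$ and, for $i=0,\dots,n-1$ (indices mod $n$), a petal consisting of the path $O,A_i,B_i,C_i$ with $\|OA_i\|=1$, $\|A_iB_i\|=l_1$, $\|B_iC_i\|=l_2$. The petal angle $\theta_i\in[0,2\pi)$ is the counterclockwise angle $\angle A_{i-1}OA_i$ from $OA_{i-1}$ to $OA_i$. Petals are indexed in counterclockwise cyclic order about $O$, so $\sum_i\theta_i=2\pi$. Parameters. Let $\bar\theta=2\pi/n$, $\beta=\arcsin l_1$, $\alpha=(2\pi-\beta)/(n-1)$, $l_P(\theta)=\cos\theta-\sqrt{l_1^2-\sin^2\theta}$ for $\theta\in[0,\beta]$, and $\theta_m=\arccos\left(\frac{1-l_1^2+l_2^2}{2l_2}\right)$ (principal values). The constraints, with $n>4$ an integer, are: (a) $l_1<1$; (b) $\bar\theta<\beta$; (c)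 $l_2<l_P(\bar\theta)$; (d) $l_2>\sin\beta\cos\beta$; (e) $l_1+l_2>1$; (f) $\alpha<\theta_m$. Restricted petals. For petal $i$ write $A,B,C$ for $A_i,B_i,C_i$, $A'$ for $A_{i-1}$, and $\theta$ for $\theta_i$. Let $L$ be the line through $O$ and $A'$, and let $\mathcal{C}$ be the circle centred at $A$ with radius $l_1$. If $\theta<\beta$, then $\mathcal{C}$ properly intersects $L$; let $P$ be the intersection point of $\mathcal{C}$ with $L$ nearer to $O$ (it lies in the interior of segment $OA'$), and let $Q$ be the intersection point of $\mathcal{C}$ with segment $OA$. The small arc $PQ$ of $\mathcal{C}$ is the shorter of the two arcs with endpoints $P,Q$; it lies inside triangle $A'OA$. If $B$ is on this arc, let $R\in OA'$ and $S\in OA$ be the feet of the perpendiculars from $B$ to $OA'$ and to $OA$. The petal is in a restricted configuration if (i) $\theta<\beta$; (ii) $B$ is on the open small arc $PQ$ of $\mathcal{C}$; and (iii) $C$ is in the open region bounded by the quadrilateral $ORBS$. *)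

theory Defs
  imports "HOL-Analysis.Analysis"
begin

record 'v linkage =
  verts :: "'v set"
  edges :: "'v set set"
  len :: "'v set \<Rightarrow> real"

definition adjacency :: "'v set set \<Rightarrow> ('v \<times> 'v) set" where
  "adjacency E = {(u, v). {u, v} \<in> E}"

text \<open>Acyclicity is expressed by saying that deleting any edge disconnects its two ends.\<close>

definition tree_linkage :: "'v linkage \<Rightarrow> bool" where
  "tree_linkage K \<longleftrightarrow>
     finite (verts K) \<and> verts K \<noteq> {} \<and>
     (\<forall>e \<in> edges K. \<exists>u \<in> verts K. \<exists>v \<in> verts K. u \<noteq> v \<and> e = {u, v}) \<and>
     (\<forall>u \<in> verts K. \<forall>v \<in> verts K. (u, v) \<in> (adjacency (edges K))\<^sup>*) \<and>
     (\<forall>u v. {u, v} \<in> edges K \<longrightarrow> (u, v) \<notin> (adjacency (edges K - {{u, v}}))\<^sup>*) \<and>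
     (\<forall>e \<in> edges K. 0 < len K e)"

text \<open>For an edge \<open>{u, v}\<close> this is the closed segment from \<open>p u\<close> to \<open>p v\<close>
  (see \<open>segment_convex_hull\<close>).\<close>

definition link :: "('v \<Rightarrow> complex) \<Rightarrow> 'v set \<Rightarrow> complex set" where
  "link p e = convex hull (p ` e)"

text \<open>Distinct edges share at most one vertex, so \<open>p ` (e \<inter> f)\<close> is either the
  single common joint or empty.\<close>

definition configuration :: "'v linkage \<Rightarrow> ('v \<Rightarrow> complex) \<Rightarrow> bool" where
  "configuration K p \<longleftrightarrow>
     (\<forall>u v. {u, v} \<in> edges K \<longrightarrow> dist (p u) (p v) = len K {u, v}) \<and>
     (\<forall>e \<in> edges K. \<forall>f \<in> edges K. e \<noteq> f \<longrightarrow> link p e \<inter> link p f = p ` (e \<inter> f))"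

text \<open>Time is normalised to \<open>{0..1}\<close>; \<open>path\<close> is continuity on that interval.\<close>

definition motion :: "'v linkage \<Rightarrow> (real \<Rightarrow> 'v \<Rightarrow> complex) \<Rightarrow> bool" where
  "motion K g \<longleftrightarrow>
     (\<forall>v \<in> verts K. path (\<lambda>t. g t v)) \<and> (\<forall>t \<in> {0..1}. configuration K (g t))"

datatype petal_vertex = Vo | Va nat | Vb nat | Vc nat

definition petal_tree :: "nat \<Rightarrow> real \<Rightarrow> real \<Rightarrow> petal_vertex linkage" where
  "petal_tree n l1 l2 =
     \<lparr> verts = {Vo} \<union> (\<Union>i<n. {Va i, Vb i, Vc i}),
       edges = (\<Union>i<n. {{Vo, Va i}, {Va i, Vb i}, {Vb i, Vc i}}),
       len = (\<lambda>e. if \<exists>i. e = {Va i, Vb i} then l1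
                  else if \<exists>i. e = {Vb i, Vc i} then l2
                  else 1) \<rparr>"

lemma tree_linkage_petal_tree:
  assumes "0 < l1" and "0 < l2"
  shows "tree_linkage (petal_tree n l1 l2)"
proof -
  let ?E = "edges (petal_tree n l1 l2)"
  have sym: "sym ((adjacency ?E)\<^sup>*)"
    by (intro sym_rtrancl symI) (auto simp: adjacency_def insert_commute)
  have from_hub: "(Vo, v) \<in> (adjacency ?E)\<^sup>*" if v: "v \<in> verts (petal_tree n l1 l2)" for v
  proof -
    have 1: "(Vo, Va i) \<in> adjacency ?E" "(Va i, Vb i) \<in> adjacency ?E"
      "(Vb i, Vc i) \<in> adjacency ?E" if "i < n" for i
      using that by (auto simp: adjacency_def petal_tree_def)
    from v consider "v = Vo" | i where "i < n" "v = Va i \<or> v = Vb i \<or> v = Vc i"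
      by (auto simp: petal_tree_def)
    then show ?thesis
    proof cases
      case 2
      then show ?thesis
        using 1[OF 2(1)] by (meson r_into_rtrancl rtrancl.rtrancl_into_rtrancl)
    qed simp
  qed
  have conn: "(u, v) \<in> (adjacency ?E)\<^sup>*"
    if "u \<in> verts (petal_tree n l1 l2)" "v \<in> verts (petal_tree n l1 l2)" for u v
    using from_hub that sym by (meson rtrancl_trans symD)
  have cut: "(u, v) \<notin> (adjacency (?E - {{u, v}}))\<^sup>*"
    if clo: "\<And>x y. {x, y} \<in> ?E - {{u, v}} \<Longrightarrow> x \<in> X \<longleftrightarrow> y \<in> X" and "u \<in> X \<longleftrightarrow> v \<notin> X" for u v X
  proof
    assume "(u, v) \<in> (adjacency (?E - {{u, v}}))\<^sup>*"
    then have "u \<in> X \<longleftrightarrow> v \<in> X"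
      by (induction rule: rtrancl_induct) (use clo in \<open>auto simp: adjacency_def\<close>)
    with that(2) show False by blast
  qed
  have acyc: "(u, v) \<notin> (adjacency (?E - {{u, v}}))\<^sup>*" if e: "{u, v} \<in> ?E" for u v
  proof -
    from e obtain i where
      "{u, v} = {Vo, Va i} \<or> {u, v} = {Va i, Vb i} \<or> {u, v} = {Vb i, Vc i}"
      by (auto simp: petal_tree_def)
    then show ?thesis
    proof (elim disjE)
      assume "{u, v} = {Vo, Va i}"
      then show ?thesis
        by (intro cut[where X = "{Va i, Vb i, Vc i}"]) (auto simp: petal_tree_def doubleton_eq_iff)
    next
      assume "{u, v} = {Va i, Vb i}"
      then show ?thesis
        by (intro cut[where X = "{Vb i, Vc i}"]) (auto simp: petal_tree_def doubleton_eq_iff)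
    next
      assume "{u, v} = {Vb i, Vc i}"
      then show ?thesis
        by (intro cut[where X = "{Vc i}"]) (auto simp: petal_tree_def doubleton_eq_iff)
    qed
  qed
  have ends: "\<exists>u \<in> verts (petal_tree n l1 l2). \<exists>v \<in> verts (petal_tree n l1 l2). u \<noteq> v \<and> e = {u, v}"
    if "e \<in> ?E" for e
  proof -
    from that obtain i where "i < n"
      and "e = {Vo, Va i} \<or> e = {Va i, Vb i} \<or> e = {Vb i, Vc i}"
      by (auto simp: petal_tree_def)
    moreover from \<open>i < n\<close>
    have "{Vo, Va i, Vb i, Vc i} \<subseteq> verts (petal_tree n l1 l2)"
      by (auto simp: petal_tree_def)
    ultimately show ?thesis
      by (metis insert_subset petal_vertex.distinct(1,7,11))
  qed
  have "finite (verts (petal_tree n l1 l2))" "verts (petal_tree n l1 l2) \<noteq> {}"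
    by (auto simp: petal_tree_def)
  moreover have "0 < len (petal_tree n l1 l2) e" for e
    using assms by (auto simp: petal_tree_def)
  ultimately show ?thesis
    unfolding tree_linkage_def using ends conn acyc by simp
qed

definition prev :: "nat \<Rightarrow> nat \<Rightarrow> nat" where
  "prev n i = (i + n - 1) mod n"

definition ccw_angle :: "complex \<Rightarrow> complex \<Rightarrow> complex \<Rightarrow> real" where
  "ccw_angle X Z Y = Arg2pi ((Y - Z) / (X - Z))"

definition petal_angle :: "nat \<Rightarrow> (petal_vertex \<Rightarrow> complex) \<Rightarrow> nat \<Rightarrow> real" where
  "petal_angle n p i = ccw_angle (p (Va (prev n i))) (p Vo) (p (Va i))"

definition ccw_indexed :: "nat \<Rightarrow> (petal_vertex \<Rightarrow> complex) \<Rightarrow> bool" where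
  "ccw_indexed n p \<longleftrightarrow>
     strict_mono_on {..<n} (\<lambda>i. ccw_angle (p (Va 0)) (p Vo) (p (Va i)))"

lemma sum_petal_angle:
  assumes n: "2 \<le> n" and ccw: "ccw_indexed n p" and ne: "\<And>i. i < n \<Longrightarrow> p (Va i) \<noteq> p Vo"
  shows "(\<Sum>i<n. petal_angle n p i) = 2 * pi"
proof -
  define f where "f i = ccw_angle (p (Va 0)) (p Vo) (p (Va i))" for i
  have f0: "f 0 = 0"
    using ne[of 0] n Arg2pi_of_real[of 1] by (simp add: f_def ccw_angle_def)
  have mono: "f i < f j" if "i < j" "j < n" for i j
    using ccw that by (auto simp: ccw_indexed_def f_def strict_mono_on_def)
  have fb: "0 \<le> f i" "f i < 2 * pi" for i
    by (simp_all add: f_def ccw_angle_def Arg2pi_ge_0 Arg2pi_lt_2pi)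
  have pol: "p (Va i) - p Vo =
      of_real (norm (p (Va i) - p Vo) / norm (p (Va 0) - p Vo)) * (p (Va 0) - p Vo) * cis (f i)"
    if "i < n" for i
  proof -
    let ?q = "(p (Va i) - p Vo) / (p (Va 0) - p Vo)"
    have "?q = of_real (norm ?q) * cis (f i)"
      using Arg2pi_eq[of ?q] by (simp add: f_def ccw_angle_def cis_conv_exp)
    then show ?thesis
      using ne[of 0] n by (simp add: norm_divide divide_simps)
  qed
  have ang: "ccw_angle (p (Va j)) (p Vo) (p (Va i)) = d"
    if "i < n" "j < n" "0 \<le> d" "d < 2 * pi" "cis d = cis (f i - f j)" for i j d
  proof -
    let ?q = "(p (Va i) - p Vo) / (p (Va j) - p Vo)"
    let ?r = "norm (p (Va i) - p Vo) / norm (p (Va j) - p Vo)"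
    have 0: "p (Va 0) \<noteq> p Vo" "p (Va i) \<noteq> p Vo" "p (Va j) \<noteq> p Vo"
      using ne that n by auto
    have "?q = of_real ?r * cis (f i - f j)"
      by (subst (1) pol[OF that(1)], subst (1) pol[OF that(2)])
        (use 0 in \<open>simp add: cis_divide[symmetric] divide_simps\<close>)
    then have "?q = of_real ?r * exp (\<i> * of_real d)"
      using that(5) by (simp add: cis_conv_exp)
    then show ?thesis
      unfolding ccw_angle_def using that(3,4) 0
      by (intro Arg2pi_unique[of ?r]) auto
  qed
  obtain m where m: "n = Suc m" "0 < m" using n by (cases n) auto
  have first: "petal_angle n p 0 = 2 * pi - f m"
    unfolding petal_angle_def
    using ang[of 0 m "2 * pi - f m"] fb[of m] mono[of 0 m] m f0
    by (simp add: prev_def complex_eq_iff)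
  have step: "petal_angle n p (Suc i) = f (Suc i) - f i" if "i < m" for i
  proof -
    have "Suc i + n - 1 = i + n" by simp
    then have "prev n (Suc i) = i"
      using that m unfolding prev_def by (metis less_SucI mod_add_self2 mod_less)
    then show ?thesis
      unfolding petal_angle_def
      using ang[of "Suc i" i "f (Suc i) - f i"] fb[of i] fb[of "Suc i"] mono[of i "Suc i"] that m
      by simp
  qed
  have "(\<Sum>i<n. petal_angle n p i) = 2 * pi - f m + (\<Sum>i<m. f (Suc i) - f i)"
    unfolding m(1) sum.lessThan_Suc_shift using first step by (simp add: m(1))
  then show ?thesis
    by (simp add: sum_lessThan_telescope f0)
qed

definition theta_bar :: "nat \<Rightarrow> real" where
  "theta_bar n = 2 * pi / real n"

definition beta :: "real \<Rightarrow> real" where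
  "beta l1 = arcsin l1"

definition alpha :: "nat \<Rightarrow> real \<Rightarrow> real" where
  "alpha n l1 = (2 * pi - beta l1) / (real n - 1)"

definition l_P :: "real \<Rightarrow> real \<Rightarrow> real" where
  "l_P l1 \<theta> = cos \<theta> - sqrt (l1\<^sup>2 - (sin \<theta>)\<^sup>2)"

definition theta_m :: "real \<Rightarrow> real \<Rightarrow> real" where
  "theta_m l1 l2 = arccos ((1 - l1\<^sup>2 + l2\<^sup>2) / (2 * l2))"

text \<open>The open arc traversed counterclockwise from \<open>X\<close> to \<open>Y\<close> on the circle about \<open>Z\<close>
  through \<open>X\<close> and \<open>Y\<close>.\<close>

definition ccw_open_arc :: "complex \<Rightarrow> complex \<Rightarrow> complex \<Rightarrow> complex set" where
  "ccw_open_arc Z X Y = {Z + cis t * (X - Z) | t. 0 < t \<and> t < ccw_angle X Z Y}"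

definition small_open_arc :: "complex \<Rightarrow> complex \<Rightarrow> complex \<Rightarrow> complex set" where
  "small_open_arc Z X Y =
     (if ccw_angle X Z Y \<le> ccw_angle Y Z X then ccw_open_arc Z X Y else ccw_open_arc Z Y X)"

definition open_quadrilateral ::
    "complex \<Rightarrow> complex \<Rightarrow> complex \<Rightarrow> complex \<Rightarrow> complex set" where
  "open_quadrilateral W X Y Z =
     inside (closed_segment W X \<union> closed_segment X Y \<union> closed_segment Y Z \<union> closed_segment Z W)"

text \<open>Here \<open>Q\<close>, \<open>P\<close>, \<open>R\<close>, \<open>S\<close> are uniquely determined once \<open>\<theta> < \<beta>\<close>, so it does not
  matter that they are bound existentially.\<close>

definition restricted_petal :: "nat \<Rightarrow> real \<Rightarrow> (petal_vertex \<Rightarrow> complex) \<Rightarrow> nat \<Rightarrow> bool" where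
  "restricted_petal n l1 p i \<longleftrightarrow>
     (let Z = p Vo; A' = p (Va (prev n i)); A = p (Va i); B = p (Vb i); C = p (Vc i);
          crossings = sphere A l1 \<inter> affine hull {Z, A'}
      in petal_angle n p i < beta l1 \<and>
         (\<exists>P Q R S.
            P \<in> crossings \<and> (\<forall>X \<in> crossings. X \<noteq> P \<longrightarrow> dist Z P < dist Z X) \<and>
            Q \<in> sphere A l1 \<inter> closed_segment Z A \<and>
            B \<in> small_open_arc A P Q \<and>
            R \<in> closed_segment Z A' \<and> orthogonal (B - R) (A' - Z) \<and>
            S \<in> closed_segment Z A \<and> orthogonal (B - S) (A - Z) \<and>
            C \<in> open_quadrilateral Z R B S))"

end

theory Submission
  imports Defs
begin

text \<open>The diameter of the quadrilateral \<open>ORBS\<close> is \<open>OB\<close>, because of its right angles at \<open>R\<close>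
  and \<open>S\<close>, so a restricted petal has \<open>l2 \<le> dist O B\<close>; this forces its angle to be at least
  \<open>theta_m\<close>, hence greater than \<open>alpha\<close>. As the petal angles sum to \<open>2 * pi\<close> and
  \<open>(n - 1) * alpha + beta = 2 * pi\<close>, each of them is then less than \<open>beta\<close>. This also applies to
  a limit of restricted configurations, where moreover \<open>B\<close> cannot have reached the end of its arc,
  nor \<open>C\<close> the boundary of \<open>ORBS\<close>: two links would meet, or \<open>l2\<close> would be too long.
  So being restricted with all angles in \<open>(alpha, beta)\<close> is an open and closed condition along the
  motion.\<close>

section \<open>Strict inequalities along a connected set, and the inequalities to be
  propagated\<close>

text \<open>The set where all the functions are positive is relatively open, as \<open>K\<close> is
  finite. By \<open>improve\<close> it coincides with the set where they are all nonnegative, which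
  is relatively closed. Being nonempty, it is all of \<open>S\<close>.\<close>

lemma connected_all_positive:
  fixes f :: "'k \<Rightarrow> 'a::topological_space \<Rightarrow> real"
  assumes "connected S" and "finite K"
    and cont: "\<And>k. k \<in> K \<Longrightarrow> continuous_on S (f k)"
    and improve: "\<And>t. t \<in> S \<Longrightarrow> \<forall>k\<in>K. 0 \<le> f k t \<Longrightarrow> \<forall>k\<in>K. 0 < f k t"
    and "t0 \<in> S" "\<forall>k\<in>K. 0 < f k t0"
  shows "\<forall>t\<in>S. \<forall>k\<in>K. 0 < f k t"
proof (cases "K = {}")
  case False
  let ?G = "{t \<in> S. \<forall>k\<in>K. 0 < f k t}"
  have "openin (top_of_set S) (\<Inter>k\<in>K. S \<inter> f k -` {0<..})"
    using False assms(2) cont by (intro openin_INT2) (auto intro: continuous_openin_preimage_gen)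
  moreover have "(\<Inter>k\<in>K. S \<inter> f k -` {0<..}) = ?G"
    using False by auto
  moreover have "closedin (top_of_set S) (\<Inter>k\<in>K. S \<inter> f k -` {0..})"
    using False cont by (intro closedin_Inter) (auto intro: continuous_closedin_preimage)
  moreover have "(\<Inter>k\<in>K. S \<inter> f k -` {0..}) = ?G"
  proof (intro equalityI subsetI)
    fix t assume t: "t \<in> (\<Inter>k\<in>K. S \<inter> f k -` {0..})"
    then have "t \<in> S" using False by blast
    moreover have "\<forall>k\<in>K. 0 \<le> f k t" using t by blast
    ultimately show "t \<in> ?G" using improve by blast
  qed (auto intro: less_imp_le)
  ultimately have "?G = {} \<or> ?G = S"
    using assms(1) unfolding connected_clopen by metis
  then show ?thesis
    using assms(5,6) by blast
qed simp

text \<open>Coordinates are normalised so that \<open>O = 0\<close>, \<open>A' = 1\<close>, \<open>A = cis th\<close>. Given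
  \<open>dist A B = l1 = sin be\<close>, positivity of entries 2 to 4 (counting from 0) says that \<open>B\<close> is on the
  open small arc, and positivity of the last four that \<open>C\<close> is inside \<open>ORBS\<close>.\<close>

definition margins :: "real \<Rightarrow> real \<Rightarrow> real \<Rightarrow> complex \<Rightarrow> complex \<Rightarrow> real list" where
  "margins al be th b c =
     [th - al, be - th,
      Im b, Re b * sin th - Im b * cos th, cos be - norm b,
      Im c, Re c * sin th - Im c * cos th,
      Re b - Re c, (Re b - Re c) * cos th + (Im b - Im c) * sin th]"

lemma continuous_on_margins:
  fixes S :: "real set"
  assumes "continuous_on S th" "continuous_on S b" "continuous_on S c" "j < 9"
  shows "continuous_on S (\<lambda>t. margins al be (th t) (b t) (c t) ! j)"
proof -
  from \<open>j < 9\<close> have "j = 0 \<or> j = 1 \<or> j = 2 \<or> j = 3 \<or> j = 4 \<or> j = 5 \<or> j = 6 \<or> j = 7 \<or> j = 8"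
    by auto
  then show ?thesis
    by (elim disjE; simp add: margins_def; intro continuous_intros assms(1-3))
qed

section \<open>Plane geometry of a single petal in normalised coordinates\<close>

text \<open>Oblique coordinates in the basis \<open>1\<close>, \<open>cis th\<close>: on the cone
  between the rays \<open>OA'\<close> and \<open>OA\<close> both are nonnegative, so bounds there
  reduce to sums of nonnegative terms.\<close>

lemma cone_coords:
  assumes "0 < sin th"
  obtains s t where "Re z = s + t * cos th" "Im z = t * sin th"
    "s * sin th = Re z * sin th - Im z * cos th"
    "0 \<le> Re z * sin th - Im z * cos th \<Longrightarrow> 0 \<le> s" "0 \<le> Im z \<Longrightarrow> 0 \<le> t"
proof
  show "Re z = (Re z - Im z / sin th * cos th) + Im z / sin th * cos th" by simp
  show "Im z = Im z / sin th * sin th" using assms by simp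
  show *: "(Re z - Im z / sin th * cos th) * sin th = Re z * sin th - Im z * cos th"
    using assms by (simp add: field_simps)
  show "0 \<le> Re z - Im z / sin th * cos th" if "0 \<le> Re z * sin th - Im z * cos th"
    using that[folded *] assms by (simp only: zero_le_mult_iff) linarith
  show "0 \<le> Im z \<Longrightarrow> 0 \<le> Im z / sin th" using assms by simp
qed

text \<open>The first bound holds because \<open>l2^2\<close> is \<open>(norm b)^2\<close> minus
  nonnegative inner products. For the second, the law of cosines in triangle \<open>OAB\<close>
  expresses the inner product of \<open>b\<close> and \<open>cis th\<close> through
  \<open>norm b\<close>, and that product is at least \<open>norm b * cos th\<close> since
  \<open>b\<close> lies in the cone of opening \<open>th\<close>. The third follows from the second:
  \<open>r + (cos be)^2 / r\<close> decreases for \<open>0 < r \<le> cos be\<close>, and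
  \<open>l2 \<le> norm b \<le> cos be\<close>.\<close>

lemma closed_petal_bounds:
  assumes be: "0 < be" "be < pi / 2" and th: "0 < th" "th \<le> be" and l2: "0 < l2"
    and ab: "norm (b - cis th) = sin be" and bc: "norm (c - b) = l2"
    and m: "\<forall>x\<in>set (margins al be th b c). 0 \<le> x"
  shows "l2 \<le> norm b"
    and "2 * norm b * cos th \<le> (norm b)\<^sup>2 + (cos be)\<^sup>2"
    and "2 * l2 * cos th \<le> l2\<^sup>2 + (cos be)\<^sup>2"
    and "0 \<le> Re b" and "Im b \<le> norm b * sin th"
    and "Re b * sin th - Im b * cos th \<le> norm b * sin th"
    and "0 \<le> Re b * cos th + Im b * sin th"
proof -
  have st: "0 < sin th" and ct: "0 < cos th"
    using be th by (auto intro!: sin_gt_zero cos_gt_zero)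
  have m': "0 \<le> Im b" "0 \<le> Re b * sin th - Im b * cos th" "norm b \<le> cos be"
     "0 \<le> Im c" "0 \<le> Re c * sin th - Im c * cos th" "Re c \<le> Re b"
     "0 \<le> (Re b - Re c) * cos th + (Im b - Im c) * sin th"
    using m unfolding margins_def by auto
  obtain s t where c: "Re c = s + t * cos th" "Im c = t * sin th" and "0 \<le> s" "0 \<le> t"
    using cone_coords[OF st, of c] m' by metis
  obtain u v where b: "Re b = u + v * cos th" "Im b = v * sin th"
     "u * sin th = Re b * sin th - Im b * cos th" and uv: "0 \<le> u" "0 \<le> v"
    using cone_coords[OF st, of b] m' by metis
  have sc: "(sin th)\<^sup>2 + (cos th)\<^sup>2 = 1" by simp
  show rb: "0 \<le> Re b" using b uv ct by simp
  show ba: "0 \<le> Re b * cos th + Im b * sin th"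
    using rb m'(1) st ct by simp
  have nb: "(norm b)\<^sup>2 = (Re b)\<^sup>2 + (Im b)\<^sup>2" by (simp add: cmod_power2)
  have nb2: "(norm b)\<^sup>2 = u\<^sup>2 + v\<^sup>2 + 2 * u * v * cos th"
  proof -
    have "(norm b)\<^sup>2 = u\<^sup>2 + v\<^sup>2 * ((sin th)\<^sup>2 + (cos th)\<^sup>2) + 2 * u * v * cos th"
      unfolding nb b(1,2) by algebra
    then show ?thesis unfolding sc by simp
  qed
  have "l2\<^sup>2 = (Re c - Re b)\<^sup>2 + (Im c - Im b)\<^sup>2"
    using bc by (auto simp: cmod_power2)
  \<comment> \<open>With inner products, \<open>|c - b|^2 = |b|^2 - c.(b - c) - c.b\<close>; both
    products are then split along \<open>c = s + t * cis th\<close>.\<close>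
  also have "\<dots> = (norm b)\<^sup>2 - s * (Re b - Re c) - t * ((Re b - Re c) * cos th + (Im b - Im c) * sin th)
     - s * Re b - t * (Re b * cos th + Im b * sin th)"
    unfolding nb c by algebra
  also have "\<dots> \<le> (norm b)\<^sup>2"
  proof -
    have "0 \<le> s * (Re b - Re c)" "0 \<le> t * ((Re b - Re c) * cos th + (Im b - Im c) * sin th)"
      "0 \<le> s * Re b" "0 \<le> t * (Re b * cos th + Im b * sin th)"
      using \<open>0 \<le> s\<close> \<open>0 \<le> t\<close> m' rb ba by (intro mult_nonneg_nonneg; simp)+
    moreover have "0 \<le> v \<Longrightarrow> 0 \<le> w \<Longrightarrow> 0 \<le> y \<Longrightarrow> 0 \<le> z \<Longrightarrow> x - v - w - y - z \<le> x"
      for v w x y z :: real by linarith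
    ultimately show ?thesis by (metis (no_types))
  qed
  finally have "l2\<^sup>2 \<le> (norm b)\<^sup>2" .
  then show l2b: "l2 \<le> norm b"
    by (rule power2_le_imp_le) simp
  have uvc: "0 \<le> 2 * u * v * cos th" using uv ct by (intro mult_nonneg_nonneg) simp_all
  have "u\<^sup>2 \<le> (norm b)\<^sup>2" "v\<^sup>2 \<le> (norm b)\<^sup>2"
    using nb2 uvc zero_le_power2[of u] zero_le_power2[of v] by linarith+
  then have un: "u \<le> norm b" and vn: "v \<le> norm b"
    using power2_le_imp_le[OF _ norm_ge_zero] by blast+
  show "Im b \<le> norm b * sin th" using b(2) vn st by simp
  show "Re b * sin th - Im b * cos th \<le> norm b * sin th" using b(3) un st by (metis mult_right_mono less_imp_le)
  have "(norm (b - cis th))\<^sup>2 = (norm b)\<^sup>2 + 1 - 2 * (Re b * cos th + Im b * sin th)"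
    unfolding nb cmod_power2 using sc by (simp, algebra)
  then have eq: "2 * (Re b * cos th + Im b * sin th) = (norm b)\<^sup>2 + (cos be)\<^sup>2"
    using ab by (simp add: sin_squared_eq)
  \<comment> \<open>The triangle inequality \<open>norm b \<le> u + v\<close> suffices here, because
    the inner product of \<open>b\<close> with \<open>cis th\<close> is
    \<open>u * cos th + v\<close>.\<close>
  have "norm b * cos th \<le> Re b * cos th + Im b * sin th"
  proof -
    have *: "Re b * cos th + Im b * sin th = u * cos th + v"
      unfolding b(1,2) using sc by algebra
    have "norm b \<le> u + v"
    proof (rule power2_le_imp_le)
      have "u * v * cos th \<le> u * v" using uv by (intro mult_left_le) simp_all
      then show "(norm b)\<^sup>2 \<le> (u + v)\<^sup>2" unfolding nb2 power2_sum by linarith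
    qed (use uv in simp)
    then have "norm b * cos th \<le> (u + v) * cos th" using ct by (intro mult_right_mono) simp_all
    also have "\<dots> \<le> u * cos th + v"
      using mult_left_le[OF cos_le_one[of th] uv(2)] unfolding distrib_right by linarith
    finally show ?thesis using * by simp
  qed
  then have "2 * (norm b * cos th) \<le> 2 * (Re b * cos th + Im b * sin th)"
    by (rule mult_left_mono) simp
  then show nbc: "2 * norm b * cos th \<le> (norm b)\<^sup>2 + (cos be)\<^sup>2"
    unfolding eq mult.assoc .
  have "0 < norm b" using l2 l2b by linarith
  have "l2 * (2 * norm b * cos th) \<le> l2 * ((norm b)\<^sup>2 + (cos be)\<^sup>2)"
    using nbc l2 by simp
  \<comment> \<open>This product is exactly \<open>norm b * (l2^2 + (cos be)^2) - l2 * ((norm b)^2 +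
    (cos be)^2)\<close>, so its sign carries the bound from \<open>norm b\<close> over to
    \<open>l2\<close>.\<close>
  moreover have "0 \<le> (norm b - l2) * ((cos be)\<^sup>2 - l2 * norm b)"
  proof (intro mult_nonneg_nonneg)
    have "l2 * norm b \<le> cos be * cos be"
      using l2b m'(3) l2 by (intro mult_mono) auto
    then show "0 \<le> (cos be)\<^sup>2 - l2 * norm b" by (simp add: power2_eq_square)
  qed (use l2b in simp)
  ultimately have "norm b * (2 * l2 * cos th) \<le> norm b * (l2\<^sup>2 + (cos be)\<^sup>2)"
    by (simp add: power2_eq_square algebra_simps)
  then show "2 * l2 * cos th \<le> l2\<^sup>2 + (cos be)\<^sup>2"
    using \<open>0 < norm b\<close> by simp
qed

lemma beta_bounds:
  assumes "0 < l1" "l1 < 1"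
  shows "0 < beta l1" "beta l1 < pi / 2" "sin (beta l1) = l1"
proof -
  show "0 < beta l1" using arcsin_less_arcsin[of 0 l1] assms by (simp add: beta_def)
  show "beta l1 < pi / 2" using arcsin_lt_bounded[of l1] assms by (simp add: beta_def)
  show "sin (beta l1) = l1" using assms by (simp add: beta_def)
qed

text \<open>By the law of cosines, \<open>theta_m\<close> is the angle between sides
  \<open>1\<close> and \<open>l2\<close> of a triangle whose third side is \<open>l1\<close>. The
  third estimate of \<open>closed_petal_bounds\<close> bounds \<open>cos th\<close> by the cosine of
  that angle.\<close>

lemma closed_petal_theta_m:
  assumes l: "0 < l1" "l1 < 1" "0 < l2" "1 < l1 + l2" and th: "0 < th" "th \<le> beta l1"
    and ab: "norm (b - cis th) = l1" and bc: "norm (c - b) = l2"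
    and m: "\<forall>x\<in>set (margins al (beta l1) th b c). 0 \<le> x"
  shows "theta_m l1 l2 \<le> th"
proof -
  have be: "0 < beta l1" "beta l1 < pi / 2" "sin (beta l1) = l1"
    using beta_bounds[OF l(1,2)] .
  have cb: "(cos (beta l1))\<^sup>2 = 1 - l1\<^sup>2" by (simp add: cos_squared_eq be)
  note bd = closed_petal_bounds[OF be(1,2) th l(3) ab[THEN trans, OF be(3)[symmetric]] bc m, unfolded cb]
  have 1: "cos th \<le> (1 - l1\<^sup>2 + l2\<^sup>2) / (2 * l2)"
    using bd(3) l by (simp add: le_divide_eq mult.commute algebra_simps)
  have "norm b \<le> cos (beta l1)" using m by (simp add: margins_def)
  then have "l2 \<le> 1" using bd(1) cos_le_one[of "beta l1"] by linarith
  \<comment> \<open>Such a triangle exists: \<open>0 \<le> 1 - l2 < l1\<close>. This keeps the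
    argument of \<open>arccos\<close> at most \<open>1\<close>.\<close>
  then have "(1 - l2)\<^sup>2 \<le> l1\<^sup>2" using l by (intro power_mono) auto
  then have 2: "(1 - l1\<^sup>2 + l2\<^sup>2) / (2 * l2) \<le> 1"
    using l by (simp add: power2_diff divide_le_eq)
  have "arccos ((1 - l1\<^sup>2 + l2\<^sup>2) / (2 * l2)) \<le> arccos (cos th)"
    using 1 2 by (intro arccos_le_arccos) auto
  moreover have "arccos (cos th) = th"
    using th be(2) by (intro arccos_cos) auto
  ultimately show ?thesis by (simp add: theta_m_def)
qed

text \<open>Each boundary case is excluded in turn. If \<open>B\<close> or \<open>C\<close> were on
  the ray \<open>OA'\<close>, or \<open>C\<close> on the ray \<open>OA\<close>, it would lie on a
  link. If \<open>B\<close> were on the ray \<open>OA\<close>, it would be too close to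
  \<open>O\<close>. If \<open>C\<close> were on the line \<open>BR\<close> or \<open>BS\<close>,
  then \<open>l2\<close> would be at most the distance from \<open>B\<close> to a side of the cone,
  which is too short.\<close>

lemma open_petal_of_closed:
  assumes l: "0 < l1" "l1 < 1" "0 < l2" "1 < l1 + l2" "sin (beta l1) * cos (beta l1) < l2"
    and th: "0 < th" "al < th" "th < beta l1"
    and ab: "norm (b - cis th) = l1" and bc: "norm (c - b) = l2"
    and m: "\<forall>x\<in>set (margins al (beta l1) th b c). 0 \<le> x"
    and b1: "b \<notin> closed_segment 0 1"
    and c1: "c \<notin> closed_segment 0 1" and c2: "c \<notin> closed_segment 0 (cis th)"
  shows "\<forall>x\<in>set (margins al (beta l1) th b c). 0 < x"
proof -
  define be where "be = beta l1"
  have be: "0 < be" "be < pi / 2" "sin be = l1"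
    using beta_bounds[OF l(1,2)] by (simp_all add: be_def)
  have thb: "th < be" using th by (simp add: be_def)
  have st: "0 < sin th" and ct: "0 < cos th" and cb: "0 < cos be" and sb: "0 < sin be"
    using be th thb by (auto intro!: sin_gt_zero cos_gt_zero)
  have ccb: "cos be < cos th" using thb th be by (intro cos_monotone_0_pi) auto
  have ssb: "sin th < sin be" using thb th be by (intro sin_monotone_2pi) auto
  note bd = closed_petal_bounds[OF be(1,2) th(1) less_imp_le[OF thb] l(3) ab[folded be(3)] bc m[folded be_def]]
  have m': "0 \<le> Im b" "0 \<le> Re b * sin th - Im b * cos th" "norm b \<le> cos be"
     "0 \<le> Im c" "0 \<le> Re c * sin th - Im c * cos th" "Re c \<le> Re b"
     "0 \<le> (Re b - Re c) * cos th + (Im b - Im c) * sin th"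
    using m unfolding margins_def be_def[symmetric] by auto
  \<comment> \<open>\<open>norm b = cos be\<close> would turn the second bound into
    \<open>cos th \<le> cos be\<close>, against \<open>th < be\<close>.\<close>
  have b_lt: "norm b < cos be"
  proof (rule ccontr)
    assume "\<not> ?thesis"
    then have "norm b = cos be" using m' by simp
    then have "cos be * cos th \<le> cos be * cos be" using bd(2) by (simp add: power2_eq_square)
    then show False using ccb cb by simp
  qed
  then have b_lt1: "norm b < 1" using cos_le_one[of be] by linarith
  have real_seg: "z \<in> closed_segment 0 1" if "Im z = 0" "0 \<le> Re z" "Re z \<le> 1" for z :: complex
    unfolding in_segment using that by (intro exI[of _ "Re z"]) (simp add: complex_eq_iff)
  have on_ray: "z = of_real (Re z * cos th + Im z * sin th) * cis th"
    if "Re z * sin th - Im z * cos th = 0" for z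
  proof -
    have 1: "Re z * sin th = Im z * cos th" using that by simp
    have sc: "sin th * sin th + cos th * cos th = 1" by (metis sin_cos_squared_add power2_eq_square)
    have A: "Re z = (Re z * cos th + Im z * sin th) * cos th"
      and B: "Im z = (Re z * cos th + Im z * sin th) * sin th"
      using 1 sc by algebra+
    show ?thesis using A B by (simp add: complex_eq_iff)
  qed
  have "Im b \<noteq> 0"
    using real_seg[of b] b1 bd(4) b_lt1 complex_Re_le_cmod[of b] by fastforce
  \<comment> \<open>On the ray \<open>OA\<close> the joint \<open>B\<close> would have distance
    \<open>1 - l1\<close> from \<open>O\<close>, but
    \<open>1 - l1 < l2 \<le> norm b\<close>.\<close>
  moreover have "Re b * sin th - Im b * cos th \<noteq> 0"
  proof
    assume "Re b * sin th - Im b * cos th = 0"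
    then obtain r where r: "b = of_real r * cis th" "0 \<le> r"
      using on_ray bd(7) by blast
    have nr: "norm b = r" using r by (simp add: norm_mult)
    have "b - cis th = of_real (r - 1) * cis th" using r by (simp add: algebra_simps)
    then have "norm (b - cis th) = \<bar>r - 1\<bar>" by (metis norm_mult norm_of_real norm_cis mult.right_neutral)
    then have "l1 = 1 - r" using ab nr b_lt1 by simp
    then show False using l bd(1) nr by simp
  qed
  moreover have "Im c \<noteq> 0"
  proof
    assume "Im c = 0"
    then have "0 \<le> Re c" using m'(5) st by (simp add: zero_le_mult_iff)
    then show False
      using real_seg[of c] c1 \<open>Im c = 0\<close> m'(6) b_lt1 complex_Re_le_cmod[of b] by simp
  qed
  moreover have "Re c * sin th - Im c * cos th \<noteq> 0"
  proof
    assume *: "Re c * sin th - Im c * cos th = 0"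
    let ?s = "Re c * cos th + Im c * sin th"
    have "0 \<le> Re c" using * m'(4) st ct
      by (metis (no_types, opaque_lifting) diff_eq_diff_eq diff_self mult_nonneg_nonneg less_imp_le zero_le_mult_iff not_le)
    then have s0: "0 \<le> ?s" using m'(4) st ct by simp
    have "?s \<le> Re b * cos th + Im b * sin th" using m'(7) by (simp add: algebra_simps)
    also have "\<dots> = Re (b * cnj (cis th))" by simp
    also have "\<dots> \<le> norm b" using complex_Re_le_cmod[of "b * cnj (cis th)"] by (simp add: norm_mult)
    finally have "?s \<le> 1" using b_lt1 by simp
    then have "c \<in> closed_segment 0 (cis th)"
      unfolding in_segment using s0 on_ray[OF *]
      by (intro exI[of _ ?s]) (simp add: scaleR_conv_of_real)
    then show False using c2 by simp
  qed
  \<comment> \<open>\<open>norm b * sin th\<close> bounds the distance of \<open>B\<close> from both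
    rays, so this is the step that rules out \<open>C\<close> on the lines \<open>BR\<close> and
    \<open>BS\<close>.\<close>
  moreover have small: "norm b * sin th < l2"
  proof -
    have "norm b * sin th \<le> cos be * sin be"
      using b_lt ssb st cb by (intro mult_mono) auto
    then show ?thesis using l(5) by (simp add: be_def mult.commute)
  qed
  have l2sq: "l2\<^sup>2 = (Re b - Re c)\<^sup>2 + (Im b - Im c)\<^sup>2"
    using bc by (auto simp: cmod_power2 power2_commute)
  have "Re b - Re c \<noteq> 0"
  proof
    assume *: "Re b - Re c = 0"
    then have "0 \<le> Im b - Im c" using m'(7) st by (simp add: zero_le_mult_iff)
    then have "l2 = Im b - Im c" using * l2sq l(3) by (simp add: power2_eq_iff)
    then show False using bd(5) small m'(4) by linarith
  qed
  moreover have "(Re b - Re c) * cos th + (Im b - Im c) * sin th \<noteq> 0"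
  proof
    assume *: "(Re b - Re c) * cos th + (Im b - Im c) * sin th = 0"
    \<comment> \<open>\<open>?k\<close> is the component of \<open>b - c\<close> normal to
      \<open>OA\<close>. The parallel component vanishes by assumption, so \<open>l2\<close> equals
      \<open>?k\<close> up to sign.\<close>
    let ?k = "(Re b - Re c) * sin th - (Im b - Im c) * cos th"
    have "l2\<^sup>2 = ((Re b - Re c)\<^sup>2 + (Im b - Im c)\<^sup>2) * ((sin th)\<^sup>2 + (cos th)\<^sup>2)"
      using l2sq by simp
    also have "\<dots> = ?k\<^sup>2 + ((Re b - Re c) * cos th + (Im b - Im c) * sin th)\<^sup>2"
      by algebra
    finally have "l2\<^sup>2 = ?k\<^sup>2" using * by simp
    moreover have "0 \<le> ?k"
    proof -
      have "(Im b - Im c) * sin th = - ((Re b - Re c) * cos th)" using * by linarith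
      then have "(Im b - Im c) * sin th \<le> 0" using m'(6) ct by simp
      then have "Im b - Im c \<le> 0" using st by (simp add: mult_le_0_iff)
      then have "(Im b - Im c) * cos th \<le> 0" using ct by (simp add: mult_le_0_iff)
      moreover have "0 \<le> (Re b - Re c) * sin th" using m'(6) st by simp
      ultimately show ?thesis by linarith
    qed
    ultimately have "l2 = ?k" using l(3) by (simp add: power2_eq_iff)
    also have "\<dots> = (Re b * sin th - Im b * cos th) - (Re c * sin th - Im c * cos th)"
      by (simp add: algebra_simps)
    finally show False using bd(6) small m'(5) by linarith
  qed
  ultimately have "0 < Im b" "0 < Re b * sin th - Im b * cos th" "0 < Im c"
    "0 < Re c * sin th - Im c * cos th" "0 < Re b - Re c"
    "0 < (Re b - Re c) * cos th + (Im b - Im c) * sin th"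
    using m' by linarith+
  moreover have "0 < th - al" "0 < be - th" "0 < cos be - norm b"
    using b_lt th thb by linarith+
  ultimately show ?thesis
    unfolding margins_def be_def[symmetric] list.set by blast
qed

text \<open>A convex set containing the boundary curve contains its inside; that inside is open,
  hence lies in the interior of the half-plane, which gives strictness. The linear functional is
  written in the coordinate \<open>(x - z) / u\<close> to fit the normalised petal.\<close>

lemma open_quadrilateral_halfplane:
  assumes "v \<noteq> 0" "u \<noteq> 0" and C: "C \<in> open_quadrilateral W X Y Z"
    and "\<forall>V \<in> {W, X, Y, Z}. k \<le> Re (v * ((V - z) / u))"
  shows "k < Re (v * ((C - z) / u))"
proof -
  \<comment> \<open>The conjugate appears because \<open>Re (w * x)\<close> is the real inner
    product of \<open>cnj w\<close> and \<open>x\<close>.\<close>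
  let ?w = "cnj (v / u)" and ?m = "k + Re (v / u * z)"
  let ?T = "{x. ?w \<bullet> x \<ge> ?m}"
  let ?Q = "closed_segment W X \<union> closed_segment X Y \<union> closed_segment Y Z \<union> closed_segment Z W"
  have re: "Re (v * ((x - z) / u)) = ?w \<bullet> x - Re (v / u * z)" for x
  proof -
    have "v * ((x - z) / u) = v / u * x - v / u * z"
      using assms(2) by (simp add: field_simps)
    then have "Re (v * ((x - z) / u)) = Re (v / u * x) - Re (v / u * z)"
      by simp
    also have "Re (v / u * x) = ?w \<bullet> x"
      unfolding inner_complex_def by (simp only: times_complex.sel cnj.sel)
    finally show ?thesis by simp
  qed
  have T: "x \<in> ?T \<longleftrightarrow> k \<le> Re (v * ((x - z) / u))" for x
    unfolding re by auto
  have conv: "convex ?T" by (rule convex_halfspace_ge)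
  have "{W, X, Y, Z} \<subseteq> ?T" using assms(4) T by blast
  then have "?Q \<subseteq> ?T" using conv by (simp add: closed_segment_subset)
  then have "inside ?Q \<subseteq> ?T"
    using outside_subset_convex[OF conv] inside_Int_outside[of ?Q] by blast
  moreover have "open (inside ?Q)"
    by (intro open_inside closed_Un compact_imp_closed compact_segment)
  ultimately have "inside ?Q \<subseteq> interior ?T" by (rule interior_maximal)
  also have "\<dots> = {x. ?w \<bullet> x > ?m}"
    using assms(1,2) by (intro interior_halfspace_ge) auto
  finally show ?thesis
    using C unfolding open_quadrilateral_def re by auto
qed

section \<open>Consequences of noncrossing, and continuity of coordinates and angles along a
  motion\<close>

lemma prev_props:
  assumes "i < n" "1 < n"
  shows "prev n i < n" "prev n i \<noteq> i"
proof -
  show "prev n i < n" using assms by (simp add: prev_def)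
  show "prev n i \<noteq> i"
  proof (cases i)
    case 0
    then show ?thesis using assms by (simp add: prev_def)
  next
    case (Suc j)
    then have "i + n - 1 = j + n" by simp
    then show ?thesis using assms Suc by (simp add: prev_def)
  qed
qed

lemma bij_betw_prev: "1 < n \<Longrightarrow> bij_betw (prev n) {..<n} {..<n}"
proof (rule bij_betwI[where g = "\<lambda>i. Suc i mod n"])
  fix i assume n: "1 < n" and "i \<in> {..<n}"
  then have i: "i < n" by simp
  have "Suc ((i + n - 1) mod n) mod n = Suc (i + n - 1) mod n" by (rule mod_Suc_eq)
  also have "\<dots> = i" using n i by simp
  finally show "Suc (prev n i) mod n = i" by (simp add: prev_def)
  show "prev n (Suc i mod n) = i"
  proof (cases "Suc i < n")
    case False
    then have "Suc i = n" using i by simp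
    then show ?thesis by (auto simp: prev_def)
  qed (simp add: prev_def i)
qed (auto simp: prev_def)

text \<open>Two hub links meet only at \<open>O\<close>, which separates the joints
  \<open>A\<close>. In the claim on \<open>Vb i\<close> the case \<open>j = i\<close> must be left
  out, since the link from \<open>Va i\<close> to \<open>Vb i\<close> touches its own hub link; the
  outer link from \<open>Vb i\<close> to \<open>Vc i\<close> shares no vertex with any hub
  link.\<close>

lemma petal_tree_configuration:
  assumes q: "configuration (petal_tree n l1 l2) q" and i: "i < n"
  shows "dist (q Vo) (q (Va i)) = 1" "dist (q (Va i)) (q (Vb i)) = l1"
    "dist (q (Vb i)) (q (Vc i)) = l2"
    and "j < n \<Longrightarrow> j \<noteq> i \<Longrightarrow> q (Va j) \<noteq> q (Va i)"
    and "j < n \<Longrightarrow> j \<noteq> i \<Longrightarrow> q (Vb i) \<notin> closed_segment (q Vo) (q (Va j))"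
    and "j < n \<Longrightarrow> q (Vc i) \<notin> closed_segment (q Vo) (q (Va j))"
proof -
  have e: "{Vo, Va i} \<in> edges (petal_tree n l1 l2)" "{Va i, Vb i} \<in> edges (petal_tree n l1 l2)"
    "{Vb i, Vc i} \<in> edges (petal_tree n l1 l2)" if "i < n" for i
    using that by (auto simp: petal_tree_def)
  have d: "dist (q u) (q v) = len (petal_tree n l1 l2) {u, v}"
    if "{u, v} \<in> edges (petal_tree n l1 l2)" for u v
    using q that unfolding configuration_def by blast
  show d1: "dist (q Vo) (q (Va i)) = 1"
    using d[OF e(1)[OF i]] by (simp add: petal_tree_def doubleton_eq_iff)
  show "dist (q (Va i)) (q (Vb i)) = l1"
    using d[OF e(2)[OF i]] by (simp add: petal_tree_def doubleton_eq_iff)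
  show "dist (q (Vb i)) (q (Vc i)) = l2"
    using d[OF e(3)[OF i]] by (simp add: petal_tree_def doubleton_eq_iff)
  have x: "closed_segment (q a) (q b) \<inter> closed_segment (q c) (q d) = q ` ({a, b} \<inter> {c, d})"
    if "{a, b} \<in> edges (petal_tree n l1 l2)" "{c, d} \<in> edges (petal_tree n l1 l2)" "{a, b} \<noteq> {c, d}"
    for a b c d
  proof -
    have "link q {a, b} \<inter> link q {c, d} = q ` ({a, b} \<inter> {c, d})"
      using q[unfolded configuration_def, THEN conjunct2, rule_format, OF that] .
    then show ?thesis by (simp only: link_def segment_convex_hull image_insert image_empty)
  qed
  show "q (Va j) \<noteq> q (Va i)" if "j < n" "j \<noteq> i"
  proof
    assume *: "q (Va j) = q (Va i)"
    have "closed_segment (q Vo) (q (Va i)) \<inter> closed_segment (q Vo) (q (Va j)) = {q Vo}"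
      using x[OF e(1)[OF i] e(1)[OF that(1)]] that(2) by (simp add: doubleton_eq_iff)
    moreover have "q (Va i) \<in> closed_segment (q Vo) (q (Va i)) \<inter> closed_segment (q Vo) (q (Va j))"
      unfolding * by simp
    ultimately have "q (Va i) = q Vo" by simp
    then show False using d1 by simp
  qed
  show "q (Vb i) \<notin> closed_segment (q Vo) (q (Va j))" if "j < n" "j \<noteq> i"
  proof -
    have "closed_segment (q (Va i)) (q (Vb i)) \<inter> closed_segment (q Vo) (q (Va j)) = {}"
      using x[OF e(2)[OF i] e(1)[OF that(1)]] that(2) by (simp add: doubleton_eq_iff)
    then show ?thesis using ends_in_segment by blast
  qed
  show "q (Vc i) \<notin> closed_segment (q Vo) (q (Va j))" if "j < n"
  proof -
    have "closed_segment (q (Vb i)) (q (Vc i)) \<inter> closed_segment (q Vo) (q (Va j)) = {}"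
      using x[OF e(3)[OF i] e(1)[OF that(1)]] by (simp add: doubleton_eq_iff)
    then show ?thesis using ends_in_segment by blast
  qed
qed

text \<open>The direct similarity taking \<open>O\<close> to \<open>0\<close> and \<open>A'\<close>
  to \<open>1\<close>, an isometry in every configuration of the tree because \<open>OA'\<close> has
  length 1. It brings petal \<open>i\<close> into the position assumed by
  \<open>margins\<close>.\<close>

definition petal_coord :: "nat \<Rightarrow> (petal_vertex \<Rightarrow> complex) \<Rightarrow> nat \<Rightarrow> petal_vertex \<Rightarrow> complex" where
  "petal_coord n q i v = (q v - q Vo) / (q (Va (prev n i)) - q Vo)"

lemma petal_angle_coord: "petal_angle n q i = Arg2pi (petal_coord n q i (Va i))"
  by (simp add: petal_angle_def ccw_angle_def petal_coord_def)

text \<open>The coordinate lies on the unit circle and differs from \<open>1\<close> because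
  \<open>Va i\<close> and \<open>Va (prev n i)\<close> do not coincide. Thus it avoids the cut where
  \<open>Arg2pi\<close> jumps, and the petal angle depends continuously on time.\<close>

lemma petal_coord_Va:
  assumes "configuration (petal_tree n l1 l2) q" and "i < n" "1 < n"
  shows "petal_coord n q i (Va i) = cis (petal_angle n q i)"
    and "petal_coord n q i (Va i) \<notin> \<real>\<^sub>\<ge>\<^sub>0"
proof -
  note pr = prev_props[OF assms(2,3)]
  let ?z = "petal_coord n q i (Va i)"
  have "norm (q (Va i) - q Vo) = 1" "norm (q (Va (prev n i)) - q Vo) = 1"
    using petal_tree_configuration(1)[OF assms(1)] assms(2) pr
    by (auto simp: dist_norm norm_minus_commute)
  then have n1: "norm ?z = 1" and nz: "q (Va (prev n i)) - q Vo \<noteq> 0"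
    by (auto simp: petal_coord_def norm_divide)
  show "?z = cis (petal_angle n q i)"
    using Arg2pi_eq[of ?z] n1 by (simp add: petal_angle_coord cis_conv_exp)
  have "?z \<noteq> 1"
    using petal_tree_configuration(4)[OF assms(1,2) pr] nz by (simp add: petal_coord_def)
  then show "?z \<notin> \<real>\<^sub>\<ge>\<^sub>0"
    using n1 by (auto elim!: nonneg_Reals_cases)
qed

text \<open>For the sum: the quotients of consecutive hub vectors multiply to \<open>1\<close>
  around the cycle, so the angle sum is always an integer multiple of \<open>2 * pi\<close>. A
  continuous function with values in this discrete set is constant, so the cyclic order need be
  known at only one time.\<close>

lemma motion_petal_angles:
  assumes g: "motion (petal_tree n l1 l2) g" and n: "1 < n"
  shows "i < n \<Longrightarrow> v \<in> verts (petal_tree n l1 l2) \<Longrightarrow>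
      continuous_on {0..1} (\<lambda>t. petal_coord n (g t) i v)" (is "_ \<Longrightarrow> _ \<Longrightarrow> ?C i v")
    and "i < n \<Longrightarrow> continuous_on {0..1} (\<lambda>t. petal_angle n (g t) i)"
    and "t \<in> {0..1} \<Longrightarrow> (\<Sum>i<n. petal_angle n (g t) i) = (\<Sum>i<n. petal_angle n (g 0) i)"
proof -
  have cfg: "configuration (petal_tree n l1 l2) (g t)" if "t \<in> {0..1}" for t
    using g that by (simp add: motion_def)
  have cont: "continuous_on {0..1} (\<lambda>t. g t v)" if "v \<in> verts (petal_tree n l1 l2)" for v
    using g that by (simp add: motion_def path_def)
  have nz: "g t (Va i) - g t Vo \<noteq> 0" if "i < n" "t \<in> {0..1}" for i t
    using petal_tree_configuration(1)[OF cfg[OF that(2)] that(1)] by auto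
  show C: "?C i v" if "i < n" "v \<in> verts (petal_tree n l1 l2)" for i v
    unfolding petal_coord_def using that n prev_props[OF that(1) n] nz
    by (intro continuous_intros cont ballI) (auto simp: petal_tree_def)
  show A: "continuous_on {0..1} (\<lambda>t. petal_angle n (g t) i)" if "i < n" for i
    unfolding petal_angle_coord
  proof (rule continuous_on_compose2[of "- \<real>\<^sub>\<ge>\<^sub>0" Arg2pi])
    show "continuous_on (- \<real>\<^sub>\<ge>\<^sub>0) Arg2pi"
      by (intro continuous_at_imp_continuous_on ballI continuous_at_Arg2pi) simp
    show "continuous_on {0..1} (\<lambda>t. petal_coord n (g t) i (Va i))"
      using that by (intro C) (auto simp: petal_tree_def)
    show "(\<lambda>t. petal_coord n (g t) i (Va i)) ` {0..1} \<subseteq> - \<real>\<^sub>\<ge>\<^sub>0"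
      using petal_coord_Va(2)[OF cfg that n] by auto
  qed
  let ?S = "\<lambda>t. \<Sum>i<n. petal_angle n (g t) i"
  have disc: "\<exists>k::int. ?S t = 2 * pi * k" if t: "t \<in> {0..1}" for t
  proof -
    let ?a = "\<lambda>i. g t (Va i) - g t Vo"
    have "cis (?S t) = (\<Prod>i<n. cis (petal_angle n (g t) i))"
      by (simp add: cis_conv_exp sum_distrib_left exp_sum)
    also have "\<dots> = (\<Prod>i<n. ?a i / ?a (prev n i))"
      using petal_coord_Va(1)[OF cfg[OF t] _ n] by (intro prod.cong) (auto simp: petal_coord_def)
    also have "\<dots> = (\<Prod>i<n. ?a i) / (\<Prod>i<n. ?a (prev n i))"
      by (rule prod_dividef)
    also have "(\<Prod>i<n. ?a (prev n i)) = (\<Prod>i<n. ?a i)"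
      by (rule prod.reindex_bij_betw[OF bij_betw_prev[OF n]])
    also have "(\<Prod>i<n. ?a i) / (\<Prod>i<n. ?a i) = 1"
      using nz[OF _ t] by simp
    finally have "cos (?S t) = 1" by (simp add: complex_eq_iff)
    then show ?thesis
      unfolding cos_one_2pi_int by (auto simp: mult_ac)
  qed
  have "?S constant_on {0..1}"
  proof (rule continuous_discrete_range_constant)
    show "continuous_on {0..1} ?S" using A by (intro continuous_on_sum) auto
    fix t :: real assume t: "t \<in> {0..1}"
    have "2 * pi \<le> norm (?S s - ?S t)" if s: "s \<in> {0..1}" "?S s \<noteq> ?S t" for s
    proof -
      obtain j k :: int where jk: "?S s = 2 * pi * j" "?S t = 2 * pi * k"
        using disc s(1) t by metis
      have "j \<noteq> k" using s(2) jk by auto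
      then have "1 \<le> \<bar>real_of_int (j - k)\<bar>" by linarith
      then have "2 * pi * 1 \<le> 2 * pi * \<bar>real_of_int (j - k)\<bar>"
        by (intro mult_left_mono) auto
      also have "\<dots> = norm (?S s - ?S t)"
        unfolding jk by (simp add: abs_mult flip: right_diff_distrib)
      finally show ?thesis by simp
    qed
    then show "\<exists>e>0. \<forall>y. y \<in> {0..1} \<and> ?S y \<noteq> ?S t \<longrightarrow> e \<le> norm (?S y - ?S t)"
      by (intro exI[of _ "2 * pi"]) auto
  qed auto
  then show "?S t = ?S 0" if "t \<in> {0..1}"
    using that by (auto simp: constant_on_def)
qed

section \<open>Translation of restricted petals into strict margins\<close>

text \<open>In normalised coordinates \<open>P\<close> is the smaller root \<open>x\<close> of a
  quadratic on the real axis, and \<open>Q\<close> is \<open>(1 - l1) * cis th\<close>. Seen from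
  \<open>A\<close>, the small arc runs counterclockwise from \<open>Q\<close> to \<open>P\<close>
  through an acute angle \<open>psi\<close>. Parametrising \<open>B\<close> by its angle
  \<open>t\<close> from \<open>Q\<close>, each claim follows from monotonicity of sine or cosine, or
  from positivity of \<open>sin t\<close>.\<close>

lemma restricted_arc:
  fixes Z u A B P Q :: complex and l1 th :: real
  defines "b \<equiv> (B - Z) / u"
  assumes l: "0 < l1" "l1 < 1" and th: "0 < th" "th < beta l1"
    and u: "norm u = 1" and A: "A - Z = cis th * u"
    and P: "P \<in> sphere A l1 \<inter> affine hull {Z, Z + u}"
    and near: "\<forall>X \<in> sphere A l1 \<inter> affine hull {Z, Z + u}. X \<noteq> P \<longrightarrow> dist Z P < dist Z X"
    and Q: "Q \<in> sphere A l1 \<inter> closed_segment Z A"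
    and B: "B \<in> small_open_arc A P Q"
  shows "0 < Im b" "0 < Re b * sin th - Im b * cos th" "norm b < cos (beta l1)"
proof -
  define be where "be = beta l1"
  have be: "0 < be" "be < pi / 2" "sin be = l1" "th < be"
    using beta_bounds[OF l] th by (simp_all add: be_def)
  have cbe: "(cos be)\<^sup>2 = 1 - l1\<^sup>2" by (simp add: cos_squared_eq be)
  have st: "0 < sin th" and ct: "0 < cos th" and cb: "0 < cos be"
    using be th by (auto intro!: sin_gt_zero cos_gt_zero)
  have ccb: "cos be < cos th" using th be by (intro cos_monotone_0_pi) auto
  have uz: "u \<noteq> 0" using u by auto
  have A': "A = Z + cis th * u" using A by (simp add: algebra_simps)
  have on_circle: "Z + of_real y * u \<in> sphere A l1 \<longleftrightarrow> y\<^sup>2 - 2 * y * cos th + (cos be)\<^sup>2 = 0" for y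
  proof -
    have "dist A (Z + of_real y * u) = norm ((cis th - of_real y) * u)"
      by (simp add: A' dist_norm algebra_simps)
    also have "\<dots> = norm (cis th - of_real y)" by (simp add: norm_mult u)
    finally have "(dist A (Z + of_real y * u))\<^sup>2 = (cos th - y)\<^sup>2 + (sin th)\<^sup>2"
      by (simp add: cmod_power2)
    also have "\<dots> = y\<^sup>2 - 2 * y * cos th + 1" unfolding sin_squared_eq by algebra
    finally have d: "(dist A (Z + of_real y * u))\<^sup>2 = y\<^sup>2 - 2 * y * cos th + 1" .
    have "dist A (Z + of_real y * u) = l1 \<longleftrightarrow> (dist A (Z + of_real y * u))\<^sup>2 = l1\<^sup>2"
      using l(1) by (subst power2_eq_iff_nonneg) auto
    then show ?thesis unfolding d mem_sphere cbe by auto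
  qed
  have hull: "Z + of_real y * u \<in> affine hull {Z, Z + u}" for y :: real
    unfolding affine_hull_2_alt by (auto simp: scaleR_conv_of_real)
  obtain x :: real where x: "P = Z + of_real x * u"
    using P unfolding affine_hull_2_alt by (auto simp: scaleR_conv_of_real)
  have qx: "x\<^sup>2 - 2 * x * cos th + (cos be)\<^sup>2 = 0" using P on_circle x by blast
  \<comment> \<open>The other root, by Vieta: the sum is \<open>2 * cos th\<close> and the product
    \<open>(cos be)^2\<close>. The nearer crossing is therefore positive and below both
    \<open>cos th\<close> and \<open>cos be\<close>.\<close>
  define y where "y = 2 * cos th - x"
  have xy: "x * y = (cos be)\<^sup>2" using qx by (simp add: y_def algebra_simps power2_eq_square)
  have "y\<^sup>2 - 2 * y * cos th + (cos be)\<^sup>2 = 0"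
    using qx unfolding y_def by algebra
  then have Y: "Z + of_real y * u \<in> sphere A l1 \<inter> affine hull {Z, Z + u}"
    using on_circle hull by blast
  have "y \<noteq> x"
  proof
    assume "y = x"
    then have "x = cos th" by (simp add: y_def)
    then have "(cos th)\<^sup>2 = (cos be)\<^sup>2" using xy \<open>y = x\<close> by (simp add: power2_eq_square)
    then show False using ccb cb ct by (simp add: power2_eq_iff_nonneg)
  qed
  then have "dist Z P < dist Z (Z + of_real y * u)"
    using near Y uz by (auto simp: x)
  then have axy: "\<bar>x\<bar> < \<bar>y\<bar>" by (simp add: x dist_norm norm_mult u)
  have "0 < x * y" using xy cb by simp
  moreover have "0 < x + y" using ct by (simp add: y_def)
  ultimately have x0: "0 < x" "0 < y"
    by (auto simp: zero_less_mult_iff)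
  have xy': "x < y" using axy x0 by simp
  have xc: "x < cos th" using xy' by (simp add: y_def)
  have "x * x < x * y" using x0 xy' by simp
  then have xb: "x < cos be"
    using xy cb x0 by (intro power2_less_imp_less[of x]) (auto simp: power2_eq_square)

  obtain s where s: "0 \<le> s" "s \<le> 1" "Q = Z + of_real s * (cis th * u)"
    using Q unfolding closed_segment_def A' by (auto simp: scaleR_conv_of_real algebra_simps)
  have Qs: "Q - A = of_real (s - 1) * (cis th * u)" by (simp add: s A' algebra_simps)
  have "norm (Q - A) = \<bar>s - 1\<bar>" unfolding Qs
    by (simp only: norm_mult norm_of_real norm_cis u) simp
  then have "s = 1 - l1" using Q s by (simp add: dist_norm norm_minus_commute)
  then have QA: "Q - A = - of_real l1 * (cis th * u)" unfolding Qs by simp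
  have PA: "P - A = (of_real x - cis th) * u" by (simp add: x A' algebra_simps)

  \<comment> \<open>The rotation about \<open>A\<close> taking \<open>Q\<close> to \<open>P\<close>.
    A positive imaginary part shows that the counterclockwise turn from \<open>Q\<close> to
    \<open>P\<close> is the one below \<open>pi\<close>, which decides the branch of
    \<open>small_open_arc\<close>.\<close>
  define q where "q = (P - A) / (Q - A)"
  define psi where "psi = Arg2pi q"
  have "q = (cis th - of_real x) / (of_real l1 * cis th)"
    unfolding q_def PA QA using uz l by (simp add: field_simps)
  also have "\<dots> = (1 - of_real x * cis (- th)) / of_real l1"
    using l by (simp add: field_simps cis_mult)
  finally have q: "q = (1 - of_real x * cis (- th)) / of_real l1" .
  have "norm q = 1"
    using P Q l(1) by (simp add: q_def norm_divide dist_norm norm_minus_commute)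
  then have qc: "q = cis psi"
    using Arg2pi_eq[of q] by (simp add: psi_def cis_conv_exp)
  have lc: "l1 * cos psi = 1 - x * cos th" and ls: "l1 * sin psi = x * sin th"
    using arg_cong[OF qc, of Re] arg_cong[OF qc, of Im] l unfolding q
    by (simp_all add: field_simps)
  have "x < 1" using xc cos_le_one[of th] by linarith
  then have "x * cos th < 1 * 1"
    using x0 ct by (intro mult_less_le_imp_less) auto
  then have "0 < l1 * cos psi" unfolding lc by simp
  then have "0 < cos psi" using l(1) by (rule zero_less_mult_pos)
  have "0 < l1 * sin psi" unfolding ls using x0 st by simp
  then have "0 < sin psi" using l(1) by (rule zero_less_mult_pos)
  then have "0 < Im q" unfolding qc by simp
  then have psi: "0 < psi" "psi < pi" using Arg2pi_lt_pi[of q] by (auto simp: psi_def)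
  have "psi < pi / 2"
  proof (rule ccontr)
    assume "\<not> ?thesis"
    then have "cos psi \<le> cos (pi / 2)" using psi by (intro cos_monotone_0_pi_le) auto
    then show False using \<open>0 < cos psi\<close> by simp
  qed
  have a1: "ccw_angle Q A P = psi" by (simp add: ccw_angle_def psi_def q_def)
  have "ccw_angle P A Q = Arg2pi (inverse q)" by (simp add: ccw_angle_def q_def)
  also have "\<dots> = 2 * pi - psi"
    using \<open>0 < Im q\<close> by (auto simp: Arg2pi_inverse psi_def complex_is_Real_iff)
  finally have "\<not> ccw_angle P A Q \<le> ccw_angle Q A P"
    using a1 psi by simp
  then obtain t where t: "B = A + cis t * (Q - A)" "0 < t" "t < psi"
    using B a1 by (auto simp: small_open_arc_def ccw_open_arc_def)
  have "B - Z = (A - Z) + cis t * (Q - A)" by (simp add: t(1))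
  also have "\<dots> = cis th * (1 - of_real l1 * cis t) * u" unfolding A QA by algebra
  finally have b_cis: "b = cis th * (1 - of_real l1 * cis t)"
    using uz by (simp add: b_def)
  then have "b = cis th - of_real l1 * cis (th + t)"
    by (simp add: algebra_simps flip: cis_mult)
  then have b: "Re b = cos th - l1 * cos (th + t)" "Im b = sin th - l1 * sin (th + t)"
    by simp_all
  have sc: "(sin th)\<^sup>2 + (cos th)\<^sup>2 = 1" "(sin t)\<^sup>2 + (cos t)\<^sup>2 = 1" by simp_all
  have "Re b * sin th - Im b * cos th = l1 * sin t"
    unfolding b cos_add sin_add using sc(1) by algebra
  moreover have "0 < sin t" using t psi by (intro sin_gt_zero) auto
  ultimately show "0 < Re b * sin th - Im b * cos th" using l by simp
  \<comment> \<open>The distance from \<open>O\<close> increases along the arc from \<open>Q\<close>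
    to \<open>P\<close>, where it equals \<open>x\<close>; so it stays below
    \<open>x < cos be\<close>.\<close>
  have "(norm b)\<^sup>2 = (norm (1 - of_real l1 * cis t))\<^sup>2"
    by (simp add: b_cis norm_mult)
  also have "\<dots> = (1 - l1 * cos t)\<^sup>2 + (l1 * sin t)\<^sup>2"
    by (simp add: cmod_power2)
  also have "\<dots> = 1 + l1\<^sup>2 - 2 * (l1 * cos t)" using sc(2) by algebra
  also have "\<dots> < 1 + l1\<^sup>2 - 2 * (l1 * cos psi)"
  proof -
    have "cos psi < cos t" using t psi by (intro cos_monotone_0_pi) auto
    then have "l1 * cos psi < l1 * cos t" using l by simp
    then show ?thesis by linarith
  qed
  also have "\<dots> = x\<^sup>2" unfolding lc using qx cbe by algebra
  finally have "norm b < x" by (rule power2_less_imp_less) (use x0 in simp)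
  then show "norm b < cos (beta l1)" using xb by (simp add: be_def)
  \<comment> \<open>In coordinates \<open>A - P = l1 * cis (th + psi)\<close>. Since
    \<open>x < cos th\<close>, this vector points to the right, so
    \<open>th + psi \<le> pi / 2\<close> and sine is increasing up to it. The height of
    \<open>B\<close> is thus greater than that of \<open>P\<close>, which is
    \<open>0\<close>.\<close>
  have "l1 * cos (th + psi) = cos th * (l1 * cos psi) - sin th * (l1 * sin psi)"
    by (simp add: cos_add algebra_simps)
  also have "\<dots> = cos th - x" unfolding lc ls using sc(1) by algebra
  finally have "0 < l1 * cos (th + psi)" using xc by simp
  then have "0 < cos (th + psi)" using l(1) by (rule zero_less_mult_pos)
  have tp: "th + psi \<le> pi / 2"
  proof (rule ccontr)
    assume "\<not> ?thesis"
    then have "cos (th + psi) \<le> cos (pi / 2)"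
      using \<open>psi < pi / 2\<close> be th by (intro cos_monotone_0_pi_le) auto
    then show False using \<open>0 < cos (th + psi)\<close> by simp
  qed
  have "l1 * sin (th + psi) = sin th * (l1 * cos psi) + cos th * (l1 * sin psi)"
    by (simp add: sin_add algebra_simps)
  also have "\<dots> = sin th" unfolding lc ls by (simp add: algebra_simps)
  finally have "sin th = l1 * sin (th + psi)" ..
  moreover have "sin (th + t) < sin (th + psi)"
    using tp th t by (intro sin_monotone_2pi) auto
  then have "l1 * sin (th + t) < l1 * sin (th + psi)" using l by simp
  ultimately show "0 < Im b" unfolding b by linarith
qed

text \<open>The orthogonality conditions give \<open>R\<close> and \<open>S\<close> the coordinates
  \<open>Re b\<close> and \<open>s * cis th\<close>, with \<open>s\<close> the inner product of
  \<open>b\<close> and \<open>cis th\<close>. Each conclusion describes an open half-plane bounded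
  by a side line of \<open>ORBS\<close>; it holds for \<open>C\<close> once the closed half-plane
  contains all four corners.\<close>

lemma restricted_quadrilateral:
  fixes Z u A B C R S :: complex and th :: real
  defines "b \<equiv> (B - Z) / u" and "c \<equiv> (C - Z) / u"
  assumes st: "0 < sin th" and ct: "0 < cos th"
    and u: "norm u = 1" and A: "A - Z = cis th * u"
    and b: "0 < Im b" "0 < Re b * sin th - Im b * cos th"
    and R: "R \<in> closed_segment Z (Z + u)" "orthogonal (B - R) u"
    and S: "S \<in> closed_segment Z A" "orthogonal (B - S) (A - Z)"
    and C: "C \<in> open_quadrilateral Z R B S"
  shows "0 < Im c" "0 < Re c * sin th - Im c * cos th" "Re c < Re b"
    "0 < (Re b - Re c) * cos th + (Im b - Im c) * sin th"
proof -
  have uz: "u \<noteq> 0" using u by auto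
  have A': "A = Z + cis th * u" using A by (simp add: algebra_simps)
  have B: "B = Z + b * u" using uz by (simp add: b_def)
  have sc: "(sin th)\<^sup>2 + (cos th)\<^sup>2 = 1" by simp
  have dot: "(v * u) \<bullet> (w * u) = v \<bullet> w" for v w
  proof -
    have "(v * u) \<bullet> (w * u) = (v \<bullet> w) * ((Re u)\<^sup>2 + (Im u)\<^sup>2)"
      unfolding inner_complex_def times_complex.sel by algebra
    then show ?thesis using u by (simp flip: cmod_power2)
  qed
  obtain r where r: "0 \<le> r" "R = Z + of_real r * u"
    using R unfolding closed_segment_def by (auto simp: scaleR_conv_of_real algebra_simps)
  have "((b - of_real r) * u) \<bullet> (1 * u) = 0"
    using R(2) by (simp add: orthogonal_def B r algebra_simps)
  then have r_eq: "r = Re b" unfolding dot by (simp add: inner_complex_def)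
  obtain s where s: "0 \<le> s" "S = Z + of_real s * (cis th * u)"
    using S unfolding closed_segment_def A' by (auto simp: scaleR_conv_of_real algebra_simps)
  have "((b - of_real s * cis th) * u) \<bullet> (cis th * u) = 0"
    using S(2) by (simp add: orthogonal_def B s A' algebra_simps)
  then have "Re b * cos th + Im b * sin th = s * (cos th * cos th) + s * (sin th * sin th)"
    unfolding dot by (simp add: inner_complex_def algebra_simps)
  then have s_eq: "s = Re b * cos th + Im b * sin th"
    by (simp only: distrib_left[symmetric] sin_cos_squared_add3 mult_1_right)
  have vs: "(Z - Z) / u = 0" "(R - Z) / u = of_real r" "(B - Z) / u = b"
    "(S - Z) / u = of_real s * cis th"
    using uz by (simp_all add: r s b_def)
  \<comment> \<open>Used with \<open>v\<close> equal to \<open>- \<i>\<close>,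
    \<open>Complex (sin th) (cos th)\<close>, \<open>-1\<close> and \<open>- cis (- th)\<close>:
    inward normals, up to conjugation, of the lines \<open>OA'\<close>, \<open>OA\<close>,
    \<open>BR\<close> and \<open>BS\<close>.\<close>
  have half: "k < Re (v * c)"
    if "v \<noteq> 0" "k \<le> 0" "k \<le> Re (v * of_real r)" "k \<le> Re (v * b)" "k \<le> Re (v * (of_real s * cis th))"
    for v k
  proof -
    have "k \<le> Re (v * ((Z - Z) / u))" "k \<le> Re (v * ((R - Z) / u))"
      "k \<le> Re (v * ((B - Z) / u))" "k \<le> Re (v * ((S - Z) / u))"
      unfolding vs using that by simp_all
    then show ?thesis
      unfolding c_def by (intro open_quadrilateral_halfplane[OF that(1) uz C]) blast
  qed
  show "0 < Im c"
    using half[of "- \<i>" 0] b(1) s(1) st by simp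
  have "0 < Re (Complex (sin th) (cos th) * c)"
    using b(2) r(1) st by (intro half) (auto simp: complex_eq_iff algebra_simps)
  then show "0 < Re c * sin th - Im c * cos th" by (simp add: algebra_simps)
  \<comment> \<open>\<open>S\<close> lies on the same closed side of the line \<open>BR\<close> as
    \<open>O\<close>; the later \<open>r * cos th \<le> s\<close> is the analogue for
    \<open>R\<close> and the line \<open>BS\<close>.\<close>
  have "s * cos th \<le> Re b"
  proof -
    have "Re b = s * cos th + (Re b * sin th - Im b * cos th) * sin th"
      unfolding s_eq using sc by algebra
    moreover have "0 \<le> (Re b * sin th - Im b * cos th) * sin th"
      using b(2) st by simp
    ultimately show ?thesis by linarith
  qed
  then show "Re c < Re b"
    using half[of "-1" "- Re b"] r r_eq by simp
  have "r * cos th \<le> s" using b(1) st unfolding r_eq s_eq by simp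
  moreover have "s * cos th * cos th + s * sin th * sin th = s" using sc by algebra
  ultimately have "- s < Re (- cis (- th) * c)"
    using s(1) by (intro half) (auto simp: s_eq[symmetric] algebra_simps, simp_all add: s_eq algebra_simps)
  then show "0 < (Re b - Re c) * cos th + (Im b - Im c) * sin th"
    by (simp add: s_eq algebra_simps)
qed

lemma restricted_petal_margins:
  assumes l: "0 < l1" "l1 < 1" and al: "0 < al"
    and q: "configuration (petal_tree n l1 l2) q" and i: "i < n" "1 < n"
    and th: "petal_angle n q i \<in> {al<..<beta l1}"
    and res: "restricted_petal n l1 q i"
  shows "\<forall>x \<in> set (margins al (beta l1) (petal_angle n q i)
    (petal_coord n q i (Vb i)) (petal_coord n q i (Vc i))). 0 < x"
proof -
  define Z u A B C where defs: "Z = q Vo" "u = q (Va (prev n i)) - q Vo" "A = q (Va i)"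
    "B = q (Vb i)" "C = q (Vc i)"
  define th where "th = petal_angle n q i"
  have A': "q (Va (prev n i)) = Z + u" by (simp add: defs)
  have u: "norm u = 1"
    using petal_tree_configuration(1)[OF q prev_props(1)[OF i]]
    by (simp add: defs dist_norm norm_minus_commute)
  have A: "A - Z = cis th * u"
  proof -
    have "(A - Z) / u = cis th"
      using petal_coord_Va(1)[OF q i] by (simp add: petal_coord_def defs th_def)
    moreover have "u \<noteq> 0" using u by auto
    ultimately show ?thesis by (simp add: nonzero_divide_eq_eq)
  qed
  have t: "0 < th" "al < th" "th < beta l1" using th al by (auto simp: th_def)
  have st: "0 < sin th" "0 < cos th"
    using t beta_bounds[OF l] by (auto intro!: sin_gt_zero cos_gt_zero)
  obtain P Q R S where
    P: "P \<in> sphere A l1 \<inter> affine hull {Z, Z + u}"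
      "\<forall>X \<in> sphere A l1 \<inter> affine hull {Z, Z + u}. X \<noteq> P \<longrightarrow> dist Z P < dist Z X"
    and Q: "Q \<in> sphere A l1 \<inter> closed_segment Z A"
    and B: "B \<in> small_open_arc A P Q"
    and R: "R \<in> closed_segment Z (Z + u)" "orthogonal (B - R) u"
    and S: "S \<in> closed_segment Z A" "orthogonal (B - S) (A - Z)"
    and C: "C \<in> open_quadrilateral Z R B S"
    using res unfolding restricted_petal_def Let_def defs(1,3-5)[symmetric] A' add_diff_cancel_left'
    by (elim conjE exE)
  note arc = restricted_arc[OF l t(1,3) u A P Q B]
  note quad = restricted_quadrilateral[OF st u A arc(1,2) R S C]
  have "petal_coord n q i (Vb i) = (B - Z) / u" "petal_coord n q i (Vc i) = (C - Z) / u"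
    by (simp_all add: petal_coord_def defs)
  then show ?thesis
    using t arc quad by (simp add: margins_def flip: th_def)
qed

section \<open>All petals together, and the continuity argument for the motion\<close>

text \<open>This supplies the \<open>improve\<close> premise of
  \<open>connected_all_positive\<close>. The order matters: the strict lower bound is obtained for
  every petal first, as the strict upper bound for one petal rests on the lower bounds for the
  others, and \<open>open_petal_of_closed\<close> needs both.\<close>

lemma configuration_margins:
  assumes n: "4 < n" and l: "0 < l1" "l1 < 1" "0 < l2" "1 < l1 + l2"
      "sin (beta l1) * cos (beta l1) < l2"
    and al: "alpha n l1 < theta_m l1 l2"
    and q: "configuration (petal_tree n l1 l2) q"
    and sum: "(\<Sum>i<n. petal_angle n q i) = 2 * pi"
    and m: "\<And>i. i < n \<Longrightarrow> \<forall>x \<in> set (margins (alpha n l1) (beta l1) (petal_angle n q i)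
      (petal_coord n q i (Vb i)) (petal_coord n q i (Vc i))). 0 \<le> x"
    and i: "i < n"
  shows "\<forall>x \<in> set (margins (alpha n l1) (beta l1) (petal_angle n q i)
      (petal_coord n q i (Vb i)) (petal_coord n q i (Vc i))). 0 < x"
proof -
  let ?th = "petal_angle n q" and ?b = "\<lambda>i. petal_coord n q i (Vb i)"
    and ?c = "\<lambda>i. petal_coord n q i (Vc i)"
  have n1: "1 < n" using n by simp
  note be = beta_bounds[OF l(1,2)]
  have apos: "0 < alpha n l1" using be(1,2) pi_gt_zero n unfolding alpha_def
    by (intro divide_pos_pos) linarith+
  have u: "norm (q (Va (prev n i)) - q Vo) = 1" if "i < n" for i
    using petal_tree_configuration(1)[OF q prev_props(1)[OF that n1]]
    by (simp add: dist_norm norm_minus_commute)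
  have nz: "q (Va (prev n i)) - q Vo \<noteq> 0" if "i < n" for i
    using u[OF that] by auto
  have d: "norm (petal_coord n q i v - petal_coord n q i w) = dist (q w) (q v)" if "i < n" for i v w
    unfolding petal_coord_def diff_divide_distrib[symmetric] norm_divide u[OF that]
    by (simp add: dist_norm norm_minus_commute)
  have ab: "norm (?b i - cis (?th i)) = l1" and bc: "norm (?c i - ?b i) = l2" if "i < n" for i
    unfolding petal_coord_Va(1)[OF q that n1, symmetric] d[OF that]
    using petal_tree_configuration(2,3)[OF q that] by simp_all
  have rng: "alpha n l1 \<le> ?th i" "?th i \<le> beta l1" if "i < n" for i
    using m[OF that] by (simp_all add: margins_def)
  have low: "alpha n l1 < ?th i" if "i < n" for i
  proof -
    have "theta_m l1 l2 \<le> ?th i"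
      using apos rng[OF that] ab[OF that] bc[OF that] m[OF that]
      by (intro closed_petal_theta_m[OF l(1-4)]) auto
    then show ?thesis using al by simp
  qed
  have up: "?th i < beta l1" if "i < n" for i
  proof -
    \<comment> \<open>The other \<open>n - 1\<close> angles together exceed
      \<open>(n - 1) * alpha n l1\<close>, which equals \<open>2 * pi - beta l1\<close>; less than
      \<open>beta l1\<close> is left for petal \<open>i\<close>.\<close>
    have "(\<Sum>j \<in> {..<n} - {i}. alpha n l1) < (\<Sum>j \<in> {..<n} - {i}. ?th j)"
    proof (rule sum_strict_mono)
      have "prev n i \<in> {..<n} - {i}" using prev_props[OF that n1] by simp
      then show "{..<n} - {i} \<noteq> {}" by blast
    qed (use low in auto)
    moreover have "(\<Sum>j \<in> {..<n} - {i}. alpha n l1) = 2 * pi - beta l1"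
      using that n by (simp add: alpha_def of_nat_diff)
    moreover have "(\<Sum>j \<in> {..<n} - {i}. ?th j) = 2 * pi - ?th i"
      using sum that by (simp add: sum_diff1)
    ultimately show ?thesis by simp
  qed
  have seg: "petal_coord n q i v \<in> closed_segment 0 (petal_coord n q i w) \<Longrightarrow>
      q v \<in> closed_segment (q Vo) (q w)" for v w
  proof -
    assume "petal_coord n q i v \<in> closed_segment 0 (petal_coord n q i w)"
    then obtain s where s: "0 \<le> s" "s \<le> 1"
      "petal_coord n q i v = of_real s * petal_coord n q i w"
      unfolding closed_segment_def by (auto simp: scaleR_conv_of_real)
    have "q v - q Vo = of_real s * (q w - q Vo)"
      using s(3) nz[OF i] by (simp add: petal_coord_def)
    then have "q v = (1 - s) *\<^sub>R q Vo + s *\<^sub>R q w"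
      unfolding scaleR_conv_of_real of_real_diff of_real_1 by algebra
    then show ?thesis using s(1,2) unfolding closed_segment_def by blast
  qed
  have one: "petal_coord n q i (Va (prev n i)) = 1"
    using nz[OF i] by (simp add: petal_coord_def)
  note pr = prev_props[OF i n1]
  show ?thesis
  proof (rule open_petal_of_closed[OF l _ low[OF i] up[OF i] ab[OF i] bc[OF i] m[OF i]])
    show "0 < ?th i" using apos low[OF i] by simp
    show "?b i \<notin> closed_segment 0 1"
      using seg[of "Vb i" "Va (prev n i)"] petal_tree_configuration(5)[OF q i pr] one by auto
    show "?c i \<notin> closed_segment 0 1"
      using seg[of "Vc i" "Va (prev n i)"] petal_tree_configuration(6)[OF q i pr(1)] one by auto
    show "?c i \<notin> closed_segment 0 (cis (?th i))"
      using seg[of "Vc i" "Va i"] petal_tree_configuration(6)[OF q i i] petal_coord_Va(1)[OF q i n1]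
      by auto
  qed
qed

theorem theorem5:
  fixes n :: nat and l1 l2 :: real
    and p :: "petal_vertex \<Rightarrow> complex" and g :: "real \<Rightarrow> petal_vertex \<Rightarrow> complex"
  assumes "n > 4" and "l1 > 0" and "l2 > 0"
    and "l1 < 1"
    and "theta_bar n < beta l1"
    and "l2 < l_P l1 (theta_bar n)"
    and "l2 > sin (beta l1) * cos (beta l1)"
    and "l1 + l2 > 1"
    and "alpha n l1 < theta_m l1 l2"
    and "configuration (petal_tree n l1 l2) p"
    and "ccw_indexed n p"
    and "\<forall>i<n. petal_angle n p i \<in> {alpha n l1 <..< beta l1}"
    and "\<forall>i<n. restricted_petal n l1 p i"
    and "motion (petal_tree n l1 l2) g"
    and "\<forall>v \<in> verts (petal_tree n l1 l2). g 0 v = p v"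
  shows "\<forall>t \<in> {0..1}. \<forall>i<n. petal_angle n (g t) i \<in> {alpha n l1 <..< beta l1}"
proof -
  \<comment> \<open>One continuous function for each petal and each of the nine entries of
    \<open>margins\<close>.\<close>
  let ?K = "{..<n} \<times> {..<9::nat}"
  let ?M = "\<lambda>t i. margins (alpha n l1) (beta l1) (petal_angle n (g t) i)
      (petal_coord n (g t) i (Vb i)) (petal_coord n (g t) i (Vc i))"
  have n1: "1 < n" using assms(1) by simp
  have len: "length (?M t i) = 9" for t i by (simp add: margins_def)
  have cfg: "configuration (petal_tree n l1 l2) (g t)" if "t \<in> {0..1}" for t
    using assms(14) that by (simp add: motion_def)
  \<comment> \<open>The motion starts at \<open>p\<close> only on the vertices of the linkage, so
    the hypotheses on \<open>p\<close> have to be carried over to \<open>g 0\<close> joint by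
    joint.\<close>
  have g0: "g 0 Vo = p Vo" "\<And>i. i < n \<Longrightarrow> g 0 (Va i) = p (Va i)"
    "\<And>i. i < n \<Longrightarrow> g 0 (Vb i) = p (Vb i)" "\<And>i. i < n \<Longrightarrow> g 0 (Vc i) = p (Vc i)"
    using assms(15) by (auto simp: petal_tree_def)
  have th0: "petal_angle n (g 0) i = petal_angle n p i" if "i < n" for i
    using g0 that prev_props[OF that n1] by (simp add: petal_angle_def)
  have res0: "restricted_petal n l1 (g 0) i" if "i < n" for i
    using assms(13) that prev_props[OF that n1] unfolding restricted_petal_def
    by (simp only: g0 th0 that)
  have "p (Va i) \<noteq> p Vo" if "i < n" for i
    using petal_tree_configuration(1)[OF assms(10) that] by auto
  then have "(\<Sum>i<n. petal_angle n p i) = 2 * pi"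
    using assms(1,11) by (intro sum_petal_angle) auto
  then have sum: "(\<Sum>i<n. petal_angle n (g t) i) = 2 * pi" if "t \<in> {0..1}" for t
    using motion_petal_angles(3)[OF assms(14) n1 that] th0 by simp
  have "\<forall>t \<in> {0..1}. \<forall>k \<in> ?K. 0 < (case k of (i, j) \<Rightarrow> \<lambda>t. ?M t i ! j) t"
  proof (rule connected_all_positive)
    fix k assume "k \<in> ?K"
    then obtain i j where k: "k = (i, j)" "i < n" "j < 9" by auto
    have "Vb i \<in> verts (petal_tree n l1 l2)" "Vc i \<in> verts (petal_tree n l1 l2)"
      using k(2) by (auto simp: petal_tree_def)
    then have "continuous_on {0..1} (\<lambda>t. ?M t i ! j)"
      by (intro continuous_on_margins motion_petal_angles[OF assms(14) n1] k(2,3))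
    then show "continuous_on {0..1} (case k of (i, j) \<Rightarrow> \<lambda>t. ?M t i ! j)"
      by (simp add: k(1))
  next
    fix t :: real assume t: "t \<in> {0..1}"
      and "\<forall>k \<in> ?K. 0 \<le> (case k of (i, j) \<Rightarrow> \<lambda>t. ?M t i ! j) t"
    then have "0 \<le> ?M t i ! j" if "i < n" "j < 9" for i j
      using that by fastforce
    then have "\<forall>x \<in> set (?M t i). 0 \<le> x" if "i < n" for i
      unfolding all_set_conv_all_nth len using that by blast
    then have "\<forall>x \<in> set (?M t i). 0 < x" if "i < n" for i
      by (rule configuration_margins[OF assms(1,2,4,3,8,7,9) cfg[OF t] sum[OF t] _ that])
    then show "\<forall>k \<in> ?K. 0 < (case k of (i, j) \<Rightarrow> \<lambda>t. ?M t i ! j) t"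
      unfolding all_set_conv_all_nth len by auto
  next
    have "beta l1 < pi / 2" using beta_bounds[OF assms(2,4)] by blast
    then have "0 < alpha n l1" using pi_gt_zero n1 unfolding alpha_def
      by (intro divide_pos_pos) linarith+
    then have "\<forall>x \<in> set (?M 0 i). 0 < x" if "i < n" for i
      using assms(12) th0[OF that] that
      by (intro restricted_petal_margins[OF assms(2,4) _ cfg that n1 _ res0[OF that]]) auto
    then show "\<forall>k \<in> ?K. 0 < (case k of (i, j) \<Rightarrow> \<lambda>t. ?M t i ! j) 0"
      unfolding all_set_conv_all_nth len by auto
  qed auto
  then have "\<forall>x \<in> set (?M t i). 0 < x" if "t \<in> {0..1}" "i < n" for t i
    unfolding all_set_conv_all_nth len using that by fastforce
  then show ?thesis by (simp add: margins_def)
qed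

end
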